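(* Consider the Energy Sharing Game $(N,v)$ with admission fees $c_i\ge 0$, $i\in U$. Let $\varepsilon^*$ be its least core value, let $\varepsilon_0^*$ be the least core value of the corresponding game $(N,v_0)$ without fees, let $\bar c=\max_{i\in U}c_i$, and define $$\hat\varepsilon=\min\Big\{\frac{v(N)-v(S)}{|N|-|S\cap U|}:\ S\in\mathcal{P}^a\Big\}.$$ (a) For any $\varepsilon\ge 0$ the following statements are equivalent: (i) $C_\varepsilon(N,v)\ne\emptyset$; (ii) $(\varepsilon,\dots,\varepsilon,v(N)-\varepsilon|U|)\in C_\varepsilon(N,v)$ (each user gets $\varepsilon$, the aggregator gets $v(N)-\varepsilon|U|$); (iii) $\varepsilon\le\hat\varepsilon$. (b) If $C(N,v)\ne\emptyset$, then $\varepsilon^*=\hat\varepsilon$. (c) If $C(N,v)\ne\emptyset$ and $\bar c>0$, then $\varepsilon_0^*-\bar c<\varepsilon^*\le\varepsilon_0^*$. (d) If $(N,v)$ is monotonic (i.e. $v(S)\le v(T)$ whenever $S\subseteq T\subseteq N$), then $$\varepsilon^*\ \ge\ \frac{v(N)-\max\{v(S):S\in\bar{\mathcal{P}}^a\}}{|N|}.$$ (e) If $C(N,v)\neq\emptyset$, then $$\varepsilon^*\ \le\ \min\Big\{\varepsilon_0^*,\ \frac{v(N)}{|N|},\ \frac{v(N)-\max\{v(S):S\in\bar{\mathcal{P}}^a\}}{2}\Big\}.$$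
   Context: Energy Sharing Game. The player set is $N=U\cup\{a\}$, where $U$ is a finite set of users with $|U|\ge 2$ and $a\notin U$ is the aggregator. Fix an integer $m\ge 1$. Each user $i\in U$ has: a compact set $D_i\subseteq\mathbb{R}^{n_i}\times\mathbb{R}^{2m}_+$, whose points are written $(z_i,y_i)$ with $y_i=[y_i^+,y_i^-]\in\mathbb{R}^m_+\times\mathbb{R}^m_+$, such that $D_i^z=\{z_i\in\mathbb{R}^{n_i}:(z_i,0)\in D_i\}$ is nonempty; a continuous function $f_i:\mathbb{R}^{n_i+2m}\to\mathbb{R}$; and an admission fee $c_i\ge 0$. There is also a continuous function $f_a:\mathbb{R}^m\to\mathbb{R}_+$ with $f_a(0)=0$. Put $b_i=\max\{f_i(z_i,0):z_i\in D_i^z\}$ and, for $S\subseteq N$ with $a\in S$ and $|S\cap U|\ge 2$, $$b_S=\max\Big\{\sum_{i\in S\cap U} [f_i(z_i,y_i)-c_i]+f_a\Big(\sum_{i\in S\cap U}y_i^+\Big):\ (z_i,y_i)\in D_i\ (i\in S\cap U),\ \sum_{i\in S\cap U}y_i^+=\sum_{i\in S\cap U}y_i^-\Big\}.$$ The characteristic function is $v(S)=b_S-\sum_{i\in S\cap U}b_i$ if $a\in S$ and $|S\cap U|\ge 2$, and $v(S)=0$ for every other $S\subseteq N$. $v_0$ denotes the characteristic function of the game with the same data but all admission fees replaced by $0$. Notation: $\mathcal{P}=\{S\subseteq N:S\ne\emptyset,S\ne N\}$, $\mathcal{P}^a=\{S\in\mathcal{P}:a\in S\}$, $\bar{\mathcal{P}}^a=\{S\in\mathcal{P}^a:|S|=|N|-1\}$.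 An allocation is a vector $x\in\mathbb{R}^{|N|}$, ordered with the aggregator's component last; $x(S)=\sum_{i\in S}x_i$. The strong $\varepsilon$-core is $C_\varepsilon(N,v)=\{x\in\mathbb{R}^{|N|}:x(N)=v(N),\ x(S)\ge v(S)+\varepsilon\ \forall S\in\mathcal{P}\}$; the core is $C(N,v)=C_0(N,v)$. The least core value is the largest $\varepsilon\in\mathbb{R}$ with $C_\varepsilon(N,v)\ne\emptyset$. *)

theory Defs
  imports "HOL-Analysis.Analysis"
begin

definition proper_coalitions :: "'p set \<Rightarrow> 'p set set" where
  "proper_coalitions N = {S. S \<subseteq> N \<and> S \<noteq> {} \<and> S \<noteq> N}"

definition proper_coalitions_with :: "'p set \<Rightarrow> 'p \<Rightarrow> 'p set set" where
  "proper_coalitions_with N a = {S \<in> proper_coalitions N. a \<in> S}"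

definition max_coalitions_with :: "'p set \<Rightarrow> 'p \<Rightarrow> 'p set set" where
  "max_coalitions_with N a = {S \<in> proper_coalitions_with N a. card S = card N - 1}"

text \<open>Allocations, i.e. vectors of \<open>\<real>\<^sup>N\<close>, are functions on players that are
  \<open>undefined\<close> outside \<open>N\<close>. Note the sign convention: a positive \<open>\<epsilon>\<close> shrinks the core.\<close>

definition strong_core :: "'p set \<Rightarrow> ('p set \<Rightarrow> real) \<Rightarrow> real \<Rightarrow> ('p \<Rightarrow> real) set" where
  "strong_core N v \<epsilon> =
     {x \<in> N \<rightarrow>\<^sub>E UNIV. sum x N = v N \<and> (\<forall>S\<in>proper_coalitions N. sum x S \<ge> v S + \<epsilon>)}"

definition core :: "'p set \<Rightarrow> ('p set \<Rightarrow> real) \<Rightarrow> ('p \<Rightarrow> real) set" where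
  "core N v = strong_core N v 0"

definition least_core_value :: "'p set \<Rightarrow> ('p set \<Rightarrow> real) \<Rightarrow> real" where
  "least_core_value N v = (GREATEST \<epsilon>. strong_core N v \<epsilon> \<noteq> {})"

definition monotonic_game :: "'p set \<Rightarrow> ('p set \<Rightarrow> real) \<Rightarrow> bool" where
  "monotonic_game N v \<longleftrightarrow> (\<forall>S T. S \<subseteq> T \<and> T \<subseteq> N \<longrightarrow> v S \<le> v T)"


text \<open>The dimension \<open>n i\<close> varies with the user, so \<open>\<real>\<^bsup>n i\<^esup>\<close> is the library's
  \<open>Euclidean_space (n i)\<close>: functions on \<open>nat\<close> vanishing from index \<open>n i\<close> on. The common
  dimension \<open>m \<ge> 1\<close> is the cardinality of the index type \<open>'m\<close>. A point is written
  \<open>(z, (y\<^sup>+, y\<^sup>-))\<close>.\<close>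

type_synonym 'm point = "(nat \<Rightarrow> real) \<times> (real ^ 'm) \<times> (real ^ 'm)"

definition point_space :: "nat \<Rightarrow> 'm::finite point topology" where
  "point_space k = prod_topology (Euclidean_space k) euclidean"

locale energy_sharing_game =
  fixes U :: "'p set"
    and a :: 'p
    and n :: "'p \<Rightarrow> nat"
    and D :: "'p \<Rightarrow> 'm::finite point set"
    and f :: "'p \<Rightarrow> 'm point \<Rightarrow> real"
    and fa :: "real ^ 'm \<Rightarrow> real"
    and c :: "'p \<Rightarrow> real"
  assumes finite_users: "finite U"
    and card_users: "card U \<ge> 2"
    and aggregator: "a \<notin> U"
    and D_compact: "i \<in> U \<Longrightarrow> compactin (point_space (n i)) (D i)"
    and D_nonneg: "i \<in> U \<Longrightarrow> (z, yp, ym) \<in> D i \<Longrightarrow> 0 \<le> yp \<and> 0 \<le> ym"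
    and D_no_sharing: "i \<in> U \<Longrightarrow> {z. (z, 0) \<in> D i} \<noteq> {}"
    and f_continuous: "i \<in> U \<Longrightarrow> continuous_map (point_space (n i)) euclideanreal (f i)"
    and fa_continuous: "continuous_on UNIV fa"
    and fa_nonneg: "fa y \<ge> 0"
    and fa_zero: "fa 0 = 0"
    and fee_nonneg: "i \<in> U \<Longrightarrow> c i \<ge> 0"

text \<open>\<open>GREATEST\<close> is the attained maximum, and unspecified if there is none. In the game the
  maxima are attained, by compactness and continuity.\<close>

definition standalone_value :: "('p \<Rightarrow> 'm::finite point set) \<Rightarrow> ('p \<Rightarrow> 'm point \<Rightarrow> real) \<Rightarrow> 'p \<Rightarrow> real"
  where "standalone_value D f i = (GREATEST r. r \<in> {f i (z, 0) | z. (z, 0) \<in> D i})"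

text \<open>Here \<open>W\<close> is the set of users of the coalition.\<close>

definition sharing_value ::
  "('p \<Rightarrow> 'm::finite point set) \<Rightarrow> ('p \<Rightarrow> 'm point \<Rightarrow> real) \<Rightarrow> (real ^ 'm \<Rightarrow> real) \<Rightarrow> ('p \<Rightarrow> real)
    \<Rightarrow> 'p set \<Rightarrow> real" where
  "sharing_value D f fa c W =
     (GREATEST r. r \<in> {(\<Sum>i\<in>W. f i (z i, yp i, ym i) - c i) + fa (\<Sum>i\<in>W. yp i) | z yp ym.
        (\<forall>i\<in>W. (z i, yp i, ym i) \<in> D i) \<and> (\<Sum>i\<in>W. yp i) = (\<Sum>i\<in>W. ym i)})"

definition esg_value ::
  "'p set \<Rightarrow> 'p \<Rightarrow> ('p \<Rightarrow> 'm::finite point set) \<Rightarrow> ('p \<Rightarrow> 'm point \<Rightarrow> real) \<Rightarrow> (real ^ 'm \<Rightarrow> real)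
    \<Rightarrow> ('p \<Rightarrow> real) \<Rightarrow> 'p set \<Rightarrow> real" where
  "esg_value U a D f fa c S =
     (if a \<in> S \<and> card (S \<inter> U) \<ge> 2
      then sharing_value D f fa c (S \<inter> U) - (\<Sum>i\<in>S \<inter> U. standalone_value D f i)
      else 0)"

end

theory Submission
  imports Defs
begin

text \<open>
  A coalition without the aggregator is worth nothing. Hence, in a strong \<open>\<epsilon>\<close>-core with
  \<open>\<epsilon> \<ge> 0\<close>, each user gets at least \<open>\<epsilon>\<close>, and a coalition \<open>S\<close> containing the aggregator can
  be left with at most \<open>v N\<close> minus \<open>\<epsilon>\<close> times the number of users outside \<open>S\<close>; paying exactly
  \<open>\<epsilon>\<close> to every user is therefore the best case for all these coalitions simultaneously, and
  the constraints become \<open>\<epsilon> \<le> \<epsilon>hat\<close>. Fees enter the values of the sharing problems additively,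
  as they do not affect feasibility. Every user may choose not to share, so the game without
  fees is monotonic. The comparison of the two least core values is then the termwise comparison
  of the ratios in \<open>\<epsilon>hat\<close>.
\<close>

section \<open>The threshold for the strong core when only coalitions with the aggregator have
  value\<close>

definition excess_ratio :: "'p set \<Rightarrow> 'p \<Rightarrow> ('p set \<Rightarrow> real) \<Rightarrow> 'p set \<Rightarrow> real" where
  "excess_ratio U a v S =
     (v (insert a U) - v S) / (real (card (insert a U)) - real (card (S \<inter> U)))"

definition core_threshold :: "'p set \<Rightarrow> 'p \<Rightarrow> ('p set \<Rightarrow> real) \<Rightarrow> real" where
  "core_threshold U a v =
     Min (excess_ratio U a v ` proper_coalitions_with (insert a U) a)"

definition uniform_allocation ::
  "'p set \<Rightarrow> 'p \<Rightarrow> ('p set \<Rightarrow> real) \<Rightarrow> real \<Rightarrow> 'p \<Rightarrow> real" where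
  "uniform_allocation U a v \<epsilon> =
     (\<lambda>i\<in>insert a U. if i = a then v (insert a U) - \<epsilon> * real (card U) else \<epsilon>)"

text \<open>Isolates what the core analysis uses of the energy sharing game. It is interpreted
  twice, with the given fees and with zero fees.\<close>

locale aggregator_game =
  fixes U :: "'p set" and a :: 'p and v :: "'p set \<Rightarrow> real"
  assumes finite_U: "finite U"
    and U_nonempty: "U \<noteq> {}"
    and a_notin: "a \<notin> U"
    and value_without_aggregator: "a \<notin> S \<Longrightarrow> v S = 0"
begin

lemma card_N: "real (card (insert a U)) = real (card U) + 1"
  using finite_U a_notin by simp

lemma card_users_le: "card (S \<inter> U) \<le> card U"
  using finite_U by (simp add: card_mono)

lemma denominator_pos: "real (card (insert a U)) - real (card (S \<inter> U)) > 0"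
  using card_users_le[of S] card_N by simp

lemma finite_coalitions: "finite (proper_coalitions_with (insert a U) a)"
  by (rule finite_subset[of _ "Pow (insert a U)"])
     (auto simp: proper_coalitions_with_def proper_coalitions_def finite_U)

lemma singleton_coalition: "{a} \<in> proper_coalitions_with (insert a U) a"
  using U_nonempty a_notin by (auto simp: proper_coalitions_with_def proper_coalitions_def)

lemma threshold_le:
  "S \<in> proper_coalitions_with (insert a U) a \<Longrightarrow> core_threshold U a v \<le> excess_ratio U a v S"
  using finite_coalitions by (simp add: core_threshold_def)

lemma le_threshold_iff:
  "\<epsilon> \<le> core_threshold U a v \<longleftrightarrow>
     (\<forall>S\<in>proper_coalitions_with (insert a U) a. \<epsilon> \<le> excess_ratio U a v S)"
  using finite_coalitions singleton_coalition unfolding core_threshold_def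
  by (subst Min_ge_iff) auto

lemma threshold_attained:
  obtains S where "S \<in> proper_coalitions_with (insert a U) a"
    and "core_threshold U a v = excess_ratio U a v S"
proof -
  have "core_threshold U a v \<in> excess_ratio U a v ` proper_coalitions_with (insert a U) a"
    unfolding core_threshold_def
    using finite_coalitions singleton_coalition by (intro Min_in) auto
  then show ?thesis
    using that by auto
qed

text \<open>With the denominator cleared, the factor of \<epsilon> counts each user outside
  \<open>S\<close> once, plus one for the surplus \<epsilon> that \<open>S\<close> itself must
  receive.\<close>

lemma le_excess_ratio_iff:
  "\<epsilon> \<le> excess_ratio U a v S \<longleftrightarrow>
     \<epsilon> * (real (card U) + 1 - real (card (S \<inter> U))) \<le> v (insert a U) - v S"
  using denominator_pos[of S] by (simp add: excess_ratio_def card_N pos_le_divide_eq)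

lemma coalition_split:
  assumes "S \<in> proper_coalitions_with (insert a U) a"
  shows "S = insert a (S \<inter> U)" "insert a U - S = U - S"
    "card (U - S) = card U - card (S \<inter> U)"
  using assms finite_U card_Diff_subset_Int[of U S]
  by (auto simp: proper_coalitions_with_def proper_coalitions_def Int_commute
      intro: finite_subset)

text \<open>Each single user is a worthless proper coalition and so receives at least \<epsilon>.
  Subtracting these shares for \<open>U - S\<close> from the total leaves for \<open>S\<close> an
  amount that must still cover \<open>v S + \<epsilon>\<close>. The bound holds for every real
  \<epsilon>, as the maximality in \<open>least_core_value_eq\<close> requires.\<close>

lemma strong_core_le_threshold:
  assumes x: "x \<in> strong_core (insert a U) v \<epsilon>"
  shows "\<epsilon> \<le> core_threshold U a v"
  unfolding le_threshold_iff le_excess_ratio_iff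
proof
  fix S assume S: "S \<in> proper_coalitions_with (insert a U) a"
  have user: "\<epsilon> \<le> x i" if "i \<in> U" for i
  proof -
    have "{i} \<in> proper_coalitions (insert a U)"
      using that a_notin by (auto simp: proper_coalitions_def)
    then have "v {i} + \<epsilon> \<le> sum x {i}"
      using x unfolding strong_core_def by blast
    moreover have "v {i} = 0"
      using that a_notin by (intro value_without_aggregator) auto
    ultimately show ?thesis by simp
  qed
  have "\<epsilon> * real (card (U - S)) \<le> sum x (U - S)"
    using sum_bounded_below[of "U - S" \<epsilon> x] user by (simp add: mult.commute)
  moreover have "sum x (insert a U) = sum x S + sum x (U - S)"
    using S coalition_split[OF S] finite_U sum.subset_diff[of S "insert a U" x]
    by (simp add: proper_coalitions_with_def proper_coalitions_def)
  moreover have "v S + \<epsilon> \<le> sum x S" "sum x (insert a U) = v (insert a U)"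
    using S x by (auto simp: strong_core_def proper_coalitions_with_def)
  moreover have "real (card (U - S)) = real (card U) - real (card (S \<inter> U))"
    using coalition_split(3)[OF S] card_users_le[of S] by simp
  ultimately show "\<epsilon> * (real (card U) + 1 - real (card (S \<inter> U))) \<le> v (insert a U) - v S"
    by (simp add: algebra_simps)
qed

lemma sum_uniform_allocation:
  assumes "S \<subseteq> U"
  shows "sum (uniform_allocation U a v \<epsilon>) S = \<epsilon> * real (card S)"
    and "sum (uniform_allocation U a v \<epsilon>) (insert a S) =
      v (insert a U) - \<epsilon> * (real (card U) - real (card S))"
proof -
  have "sum (uniform_allocation U a v \<epsilon>) S = (\<Sum>i\<in>S. \<epsilon>)"
    using assms a_notin by (intro sum.cong) (auto simp: uniform_allocation_def)
  then show *: "sum (uniform_allocation U a v \<epsilon>) S = \<epsilon> * real (card S)"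
    by simp
  have "finite S" "a \<notin> S"
    using assms finite_U a_notin finite_subset by auto
  then show "sum (uniform_allocation U a v \<epsilon>) (insert a S) =
      v (insert a U) - \<epsilon> * (real (card U) - real (card S))"
    using * by (simp add: uniform_allocation_def algebra_simps)
qed

text \<open>For coalitions with the aggregator, the core constraint under this allocation is exactly
  the cleared form of \<open>\<epsilon> \<le> excess_ratio U a v S\<close>. The sign of \<epsilon>
  matters only for the coalitions of users.\<close>

lemma uniform_allocation_in_strong_core:
  assumes "\<epsilon> \<ge> 0" and le: "\<epsilon> \<le> core_threshold U a v"
  shows "uniform_allocation U a v \<epsilon> \<in> strong_core (insert a U) v \<epsilon>"
proof -
  have "v S + \<epsilon> \<le> sum (uniform_allocation U a v \<epsilon>) S"
    if S: "S \<in> proper_coalitions (insert a U)" for S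
  proof (cases "a \<in> S")
    case True
    then have S': "S \<in> proper_coalitions_with (insert a U) a"
      using S by (simp add: proper_coalitions_with_def)
    then have "\<epsilon> * (real (card U) + 1 - real (card (S \<inter> U))) \<le> v (insert a U) - v S"
      using le by (simp add: le_threshold_iff le_excess_ratio_iff)
    moreover have "sum (uniform_allocation U a v \<epsilon>) S =
        v (insert a U) - \<epsilon> * (real (card U) - real (card (S \<inter> U)))"
      using sum_uniform_allocation(2)[of "S \<inter> U" \<epsilon>] coalition_split(1)[OF S'] by simp
    ultimately show ?thesis by (simp add: algebra_simps)
  next
    case False
    then have "S \<subseteq> U" "S \<noteq> {}"
      using S by (auto simp: proper_coalitions_def)
    \<comment> \<open>A worthless coalition of users receives \<epsilon> per member. It has at least
      one member, so \<open>\<epsilon> \<ge> 0\<close> makes this at least \<epsilon>.\<close>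
    then have "card S \<ge> 1"
      using finite_U finite_subset by (metis One_nat_def Suc_leI card_gt_0_iff)
    then have "\<epsilon> * 1 \<le> \<epsilon> * real (card S)"
      using \<open>\<epsilon> \<ge> 0\<close> by (intro mult_left_mono) auto
    then show ?thesis
      using sum_uniform_allocation(1)[OF \<open>S \<subseteq> U\<close>] value_without_aggregator[OF False] by simp
  qed
  then show ?thesis
    using sum_uniform_allocation(2)[of U]
    by (auto simp: strong_core_def uniform_allocation_def)
qed

lemma core_nonempty_iff: "core (insert a U) v \<noteq> {} \<longleftrightarrow> 0 \<le> core_threshold U a v"
  using strong_core_le_threshold uniform_allocation_in_strong_core[of 0]
  unfolding core_def by blast

text \<open>A nonempty core makes the threshold nonnegative, so the uniform allocation is available
  at \<epsilon> equal to the threshold and shows that the upper bound is attained.\<close>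

lemma least_core_value_eq:
  assumes "core (insert a U) v \<noteq> {}"
  shows "least_core_value (insert a U) v = core_threshold U a v"
  unfolding least_core_value_def
proof (rule Greatest_equality)
  show "strong_core (insert a U) v (core_threshold U a v) \<noteq> {}"
    using assms uniform_allocation_in_strong_core core_nonempty_iff by blast
next
  fix \<epsilon> assume "strong_core (insert a U) v \<epsilon> \<noteq> {}"
  then show "\<epsilon> \<le> core_threshold U a v"
    using strong_core_le_threshold by blast
qed

section \<open>Bounds from coalitions missing exactly one user, and from the aggregator
  alone\<close>

lemma max_coalition_card:
  assumes "S \<in> max_coalitions_with (insert a U) a"
  shows "real (card (S \<inter> U)) = real (card U) - 1"
proof -
  have S: "S \<in> proper_coalitions_with (insert a U) a" and "card S = card U"
    using assms finite_U a_notin by (auto simp: max_coalitions_with_def)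
  moreover have "card S = Suc (card (S \<inter> U))"
    using coalition_split(1)[OF S] finite_U a_notin
    by (metis Int_iff card_insert_disjoint finite_Int)
  ultimately show ?thesis by simp
qed

lemma max_coalition_above:
  assumes S: "S \<in> proper_coalitions_with (insert a U) a"
  obtains T where "T \<in> max_coalitions_with (insert a U) a" "S \<subseteq> T"
proof -
  obtain j where j: "j \<in> U" "j \<notin> S"
    using S by (auto simp: proper_coalitions_with_def proper_coalitions_def)
  show ?thesis
  proof (rule that)
    show "insert a U - {j} \<in> max_coalitions_with (insert a U) a"
      using j a_notin finite_U
      by (auto simp: max_coalitions_with_def proper_coalitions_with_def proper_coalitions_def)
    show "S \<subseteq> insert a U - {j}"
      using j S by (auto simp: proper_coalitions_with_def proper_coalitions_def)
  qed
qed

lemma finite_max_coalitions: "finite (max_coalitions_with (insert a U) a)"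
  using finite_coalitions by (auto simp: max_coalitions_with_def)

lemma max_coalitions_nonempty: "max_coalitions_with (insert a U) a \<noteq> {}"
  using max_coalition_above[OF singleton_coalition] by blast

text \<open>This is the ratio at \<open>{a}\<close>, whose denominator is the number of all
  players.\<close>

lemma threshold_le_average:
  assumes "v {a} = 0"
  shows "core_threshold U a v \<le> v (insert a U) / real (card (insert a U))"
  using threshold_le[OF singleton_coalition] assms a_notin by (simp add: excess_ratio_def)

lemma threshold_le_max_coalition:
  "core_threshold U a v
     \<le> (v (insert a U) - Max (v ` max_coalitions_with (insert a U) a)) / 2"
proof -
  have "Max (v ` max_coalitions_with (insert a U) a) \<in> v ` max_coalitions_with (insert a U) a"
    using finite_max_coalitions max_coalitions_nonempty by (intro Max_in) auto
  then obtain T where T: "T \<in> max_coalitions_with (insert a U) a"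
    and eq: "Max (v ` max_coalitions_with (insert a U) a) = v T"
    by blast
  have "core_threshold U a v \<le> excess_ratio U a v T"
    using T by (intro threshold_le) (simp add: max_coalitions_with_def)
  \<comment> \<open>One user is missing from \<open>T\<close>, so the denominator is
    \<open>card U + 1 - (card U - 1) = 2\<close>.\<close>
  also have "\<dots> = (v (insert a U) - v T) / 2"
    unfolding excess_ratio_def using max_coalition_card[OF T] card_N by simp
  finally show ?thesis
    by (simp add: eq)
qed

text \<open>Every coalition with the aggregator lies below one missing a single user, which bounds
  each numerator from below by \<open>v (insert a U) - vmax\<close>, while no denominator exceeds
  \<open>card (insert a U)\<close>. The first conclusion serves to show that the core is
  nonempty.\<close>

lemma monotonic_threshold_ge:
  assumes mono: "monotonic_game (insert a U) v"
  defines "vmax \<equiv> Max (v ` max_coalitions_with (insert a U) a)"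
  shows "0 \<le> (v (insert a U) - vmax) / real (card (insert a U))"
    and "(v (insert a U) - vmax) / real (card (insert a U)) \<le> core_threshold U a v"
proof -
  \<comment> \<open>Enlarging the denominator lowers the quotient only because this numerator is
    nonnegative.\<close>
  have vmax_le: "vmax \<le> v (insert a U)"
    unfolding vmax_def using mono finite_max_coalitions max_coalitions_nonempty
    by (subst Max_le_iff)
       (auto simp: monotonic_game_def max_coalitions_with_def proper_coalitions_with_def
        proper_coalitions_def)
  then show "0 \<le> (v (insert a U) - vmax) / real (card (insert a U))"
    by simp
  show "(v (insert a U) - vmax) / real (card (insert a U)) \<le> core_threshold U a v"
    unfolding le_threshold_iff
  proof
    fix S assume S: "S \<in> proper_coalitions_with (insert a U) a"
    then obtain T where T: "T \<in> max_coalitions_with (insert a U) a" "S \<subseteq> T"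
      using max_coalition_above by blast
    have "T \<subseteq> insert a U"
      using T by (auto simp: max_coalitions_with_def proper_coalitions_with_def proper_coalitions_def)
    then have "v S \<le> v T"
      using mono T by (auto simp: monotonic_game_def)
    also have "v T \<le> vmax"
      unfolding vmax_def using T finite_max_coalitions by simp
    finally show "(v (insert a U) - vmax) / real (card (insert a U)) \<le> excess_ratio U a v S"
      unfolding excess_ratio_def using denominator_pos[of S] vmax_le
      by (intro frac_le) auto
  qed
qed

lemma monotonic_core_nonempty:
  assumes "monotonic_game (insert a U) v"
  shows "core (insert a U) v \<noteq> {}"
  using monotonic_threshold_ge[OF assms] core_nonempty_iff by linarith

end

section \<open>Attained maxima of continuous functions on compact sets\<close>

lemma Greatest_continuous_image:
  fixes g :: "'a \<Rightarrow> real"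
  assumes "compactin X K" "K \<noteq> {}" "continuous_map X euclideanreal g"
  obtains x where "x \<in> K" "(GREATEST r. r \<in> g ` K) = g x" "\<And>y. y \<in> K \<Longrightarrow> g y \<le> g x"
proof -
  have "compact (g ` K)"
    using image_compactin[OF assms(1,3)] by simp
  then obtain x where x: "x \<in> K" "\<forall>y\<in>K. g y \<le> g x"
    using compact_attains_sup[of "g ` K"] \<open>K \<noteq> {}\<close> by auto
  then have "(GREATEST r. r \<in> g ` K) = g x"
    by (intro Greatest_equality) auto
  then show ?thesis
    using that x by blast
qed

lemma continuous_map_on_component:
  assumes "i \<in> I" "continuous_map (X i) Y g"
  shows "continuous_map (product_topology X I) Y (\<lambda>w. g (w i))"
  using continuous_map_compose[OF continuous_map_product_projection[OF assms(1), of X] assms(2)]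
  by (simp add: o_def)

lemma continuous_map_exports:
  "continuous_map (point_space k) euclidean (\<lambda>p :: 'm::finite point. fst (snd p))"
  "continuous_map (point_space k) euclidean (\<lambda>p :: 'm point. snd (snd p))"
proof -
  have snd: "continuous_map (point_space k) euclidean (snd :: 'm point \<Rightarrow> _)"
    unfolding point_space_def by (rule continuous_map_snd)
  have "continuous_map euclidean euclidean (fst :: (real^'m) \<times> (real^'m) \<Rightarrow> _)"
    "continuous_map euclidean euclidean (snd :: (real^'m) \<times> (real^'m) \<Rightarrow> _)"
    by (auto intro: continuous_intros)
  from this[THEN continuous_map_compose[OF snd]]
  show "continuous_map (point_space k) euclidean (\<lambda>p :: 'm point. fst (snd p))"
    "continuous_map (point_space k) euclidean (\<lambda>p :: 'm point. snd (snd p))"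
    by (simp_all add: o_def)
qed

text \<open>Used when a profile on \<open>V\<close> is extended to \<open>W\<close> by users who do
  not share.\<close>

lemma sum_extend:
  fixes g h :: "'p \<Rightarrow> 'b::comm_monoid_add"
  assumes "finite W" "V \<subseteq> W"
  shows "(\<Sum>i\<in>W. if i \<in> V then g i else h i) = sum g V + sum h (W - V)"
  using assms by (simp add: sum.If_cases Int_absorb1 Diff_eq)

section \<open>The optimisation problems behind the coalition values\<close>

context energy_sharing_game
begin

text \<open>Profiles are extensional on \<open>W\<close>, so that they are points of the product
  topology over \<open>W\<close>, where compactness is available.\<close>

definition feasible :: "'p set \<Rightarrow> ('p \<Rightarrow> 'm point) set" where
  "feasible W = {w \<in> PiE W D. (\<Sum>i\<in>W. fst (snd (w i))) = (\<Sum>i\<in>W. snd (snd (w i)))}"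

definition payoff :: "('p \<Rightarrow> real) \<Rightarrow> 'p set \<Rightarrow> ('p \<Rightarrow> 'm point) \<Rightarrow> real" where
  "payoff d W w = (\<Sum>i\<in>W. f i (w i) - d i) + fa (\<Sum>i\<in>W. fst (snd (w i)))"

text \<open>The slice of the compact set \<open>D i\<close> at zero exchange is closed in it, hence
  compact, and the continuous \<open>f i\<close> attains its maximum there.\<close>

lemma standalone_attained:
  assumes i: "i \<in> U"
  obtains z where "(z, 0) \<in> D i" "standalone_value D f i = f i (z, 0)"
proof -
  define K where "K = D i \<inter> {p \<in> topspace (point_space (n i)). snd p = 0}"
  have "closedin (point_space (n i)) {p \<in> topspace (point_space (n i)). snd p = (0 :: (real^'m) \<times> (real^'m))}"
    unfolding point_space_def
    by (rule closedin_continuous_maps_eq[where Y = euclidean])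
       (auto intro: continuous_map_snd)
  then have "compactin (point_space (n i)) K"
    unfolding K_def by (rule compact_Int_closedin[OF D_compact[OF i]])
  moreover have K: "K = {p \<in> D i. snd p = 0}"
    using compactin_subset_topspace[OF D_compact[OF i]] by (auto simp: K_def)
  moreover have "K \<noteq> {}"
  proof -
    obtain z where "(z, 0) \<in> D i"
      using D_no_sharing[OF i] by blast
    then have "(z, 0) \<in> K"
      by (simp add: K)
    then show ?thesis by blast
  qed
  ultimately obtain p where p: "p \<in> K" "(GREATEST r. r \<in> f i ` K) = f i p"
    using Greatest_continuous_image[OF _ _ f_continuous[OF i]] by metis
  have "f i ` K = {f i (z, 0) | z. (z, 0) \<in> D i}"
    unfolding K by force
  then have "standalone_value D f i = f i p"
    using p by (simp add: standalone_value_def)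
  then show ?thesis
    using that[of "fst p"] p unfolding K by (cases p) auto
qed

lemma feasible_nonempty:
  assumes "W \<subseteq> U"
  shows "feasible W \<noteq> {}"
proof -
  have "\<forall>i\<in>U. \<exists>z. (z, 0) \<in> D i"
    using D_no_sharing by blast
  then obtain z where z: "\<And>i. i \<in> U \<Longrightarrow> (z i, 0) \<in> D i"
    by metis
  then have "(\<lambda>i\<in>W. (z i, 0)) \<in> feasible W"
    using assms by (auto simp: feasible_def)
  then show ?thesis by blast
qed

text \<open>The product of the sets \<open>D i\<close> is compact by Tychonoff, and the balance
  equation between continuous maps cuts out a closed part.\<close>

lemma feasible_compact:
  assumes "W \<subseteq> U"
  shows "compactin (product_topology (\<lambda>i. point_space (n i)) W) (feasible W)"
proof -
  let ?X = "product_topology (\<lambda>i. point_space (n i)) W :: ('p \<Rightarrow> 'm point) topology"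
  let ?E = "{w \<in> topspace ?X. (\<Sum>i\<in>W. fst (snd (w i))) = (\<Sum>i\<in>W. snd (snd (w i)))}"
  have "finite W"
    using assms finite_users finite_subset by blast
  have "closedin ?X ?E"
    by (rule closedin_continuous_maps_eq[where Y = euclidean])
       (use \<open>finite W\<close> in \<open>auto intro!: continuous_map_sum continuous_map_on_component continuous_map_exports\<close>)
  moreover have D: "compactin ?X (PiE W D)"
    using assms D_compact by (auto simp: compactin_PiE)
  ultimately have "compactin ?X (PiE W D \<inter> ?E)"
    by (intro compact_Int_closedin)
  moreover have "PiE W D \<inter> ?E = feasible W"
    using compactin_subset_topspace[OF D] by (auto simp: feasible_def)
  ultimately show ?thesis by simp
qed

lemma payoff_continuous:
  assumes "W \<subseteq> U"
  shows "continuous_map (product_topology (\<lambda>i. point_space (n i)) W) euclideanreal (payoff d W)"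
proof -
  let ?X = "product_topology (\<lambda>i. point_space (n i)) W :: ('p \<Rightarrow> 'm point) topology"
  have "finite W"
    using assms finite_users finite_subset by blast
  have "continuous_map ?X euclidean (\<lambda>w. f i (w i))" if "i \<in> W" for i
    using that assms by (intro continuous_map_on_component f_continuous) auto
  moreover have "continuous_map ?X euclidean (\<lambda>w. \<Sum>i\<in>W. fst (snd (w i)))"
    using \<open>finite W\<close> by (intro continuous_map_sum continuous_map_on_component continuous_map_exports)
  then have "continuous_map ?X euclidean (\<lambda>w. fa (\<Sum>i\<in>W. fst (snd (w i))))"
    using continuous_map_compose[of ?X euclidean _ euclidean fa] fa_continuous
    by (simp add: o_def)
  ultimately show ?thesis
    unfolding payoff_def using \<open>finite W\<close>
    by (intro continuous_map_add continuous_map_sum continuous_map_diff) auto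
qed

text \<open>Three families \<open>z\<close>, \<open>yp\<close>, \<open>ym\<close> are merged into
  one profile, turning the set under \<open>GREATEST\<close> into a continuous image of a compact
  set.\<close>

lemma payoff_image:
  "{(\<Sum>i\<in>W. f i (z i, yp i, ym i) - d i) + fa (\<Sum>i\<in>W. yp i) | z yp ym.
      (\<forall>i\<in>W. (z i, yp i, ym i) \<in> D i) \<and> (\<Sum>i\<in>W. yp i) = (\<Sum>i\<in>W. ym i)}
    = payoff d W ` feasible W" (is "?L = _")
proof (intro equalityI subsetI)
  fix r assume "r \<in> ?L"
  then obtain z yp ym where *: "\<forall>i\<in>W. (z i, yp i, ym i) \<in> D i"
      "(\<Sum>i\<in>W. yp i) = (\<Sum>i\<in>W. ym i)"
      "r = (\<Sum>i\<in>W. f i (z i, yp i, ym i) - d i) + fa (\<Sum>i\<in>W. yp i)"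
    by blast
  define w where "w = (\<lambda>i\<in>W. (z i, yp i, ym i))"
  have "w \<in> feasible W" "r = payoff d W w"
    using * by (auto simp: w_def feasible_def payoff_def cong: sum.cong)
  then show "r \<in> payoff d W ` feasible W" by blast
next
  fix r assume "r \<in> payoff d W ` feasible W"
  then obtain w where w: "w \<in> feasible W" "r = payoff d W w" by blast
  then show "r \<in> ?L"
    unfolding mem_Collect_eq
    by (intro exI[of _ "\<lambda>i. fst (w i)"] exI[of _ "\<lambda>i. fst (snd (w i))"]
        exI[of _ "\<lambda>i. snd (snd (w i))"]) (auto simp: feasible_def payoff_def)
qed

lemma sharing_attained:
  assumes "W \<subseteq> U"
  obtains w where "w \<in> feasible W" "sharing_value D f fa d W = payoff d W w"
    "\<And>w'. w' \<in> feasible W \<Longrightarrow> payoff d W w' \<le> payoff d W w"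
  using Greatest_continuous_image[OF feasible_compact[OF assms] feasible_nonempty[OF assms]
      payoff_continuous[OF assms, of d]]
  unfolding sharing_value_def payoff_image by metis

lemma payoff_fees: "payoff d W w = payoff (\<lambda>_. 0) W w - sum d W"
  by (simp add: payoff_def sum_subtractf)

text \<open>Both problems have the same feasible set and objectives differing by the constant
  \<open>sum d W\<close>. Testing each maximiser in the other problem gives the two
  inequalities.\<close>

lemma sharing_value_fees:
  assumes "W \<subseteq> U"
  shows "sharing_value D f fa d W = sharing_value D f fa (\<lambda>_. 0) W - sum d W"
proof -
  obtain w where w: "w \<in> feasible W" "sharing_value D f fa d W = payoff d W w"
    "\<And>w'. w' \<in> feasible W \<Longrightarrow> payoff d W w' \<le> payoff d W w"
    using sharing_attained[OF assms, where d = d] by blast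
  obtain w0 where w0: "w0 \<in> feasible W"
    "sharing_value D f fa (\<lambda>_. 0) W = payoff (\<lambda>_. 0) W w0"
    "\<And>w'. w' \<in> feasible W \<Longrightarrow> payoff (\<lambda>_. 0) W w' \<le> payoff (\<lambda>_. 0) W w0"
    using sharing_attained[OF assms, where d = "\<lambda>_. 0"] by blast
  show ?thesis
    using w(2) w0(2) w(3)[OF w0(1)] w0(3)[OF w(1)] payoff_fees[of d W] by force
qed

text \<open>An optimal profile for \<open>V\<close> is extended by an optimal non-sharing choice of
  each user in \<open>W - V\<close>. The newcomers exchange nothing, so the balance and the argument
  of \<open>fa\<close> are unchanged, and the payoff grows by their standalone values.\<close>

lemma sharing_value_superset:
  assumes "V \<subseteq> W" "W \<subseteq> U"
  shows "sharing_value D f fa (\<lambda>_. 0) V + (\<Sum>i\<in>W - V. standalone_value D f i)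
    \<le> sharing_value D f fa (\<lambda>_. 0) W"
proof -
  have "finite W" "V \<subseteq> U"
    using assms finite_users finite_subset by blast+
  obtain w where w: "w \<in> feasible V"
    "sharing_value D f fa (\<lambda>_. 0) V = payoff (\<lambda>_. 0) V w"
    by (rule sharing_attained[OF \<open>V \<subseteq> U\<close>, where d = "\<lambda>_. 0"])
  have "\<forall>i\<in>U. \<exists>z. (z, 0) \<in> D i \<and> standalone_value D f i = f i (z, 0)"
  proof
    fix i assume "i \<in> U"
    then show "\<exists>z. (z, 0) \<in> D i \<and> standalone_value D f i = f i (z, 0)"
      by (rule standalone_attained) (intro exI conjI)
  qed
  from bchoice[OF this]
  obtain z where z: "\<forall>i\<in>U. (z i, 0) \<in> D i \<and> standalone_value D f i = f i (z i, 0)" ..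
  define w' where "w' = (\<lambda>i\<in>W. if i \<in> V then w i else (z i, 0))"
  have "(\<Sum>i\<in>W. fst (snd (w' i))) = (\<Sum>i\<in>W. if i \<in> V then fst (snd (w i)) else 0)"
    by (intro sum.cong) (auto simp: w'_def)
  then have fst_sum: "(\<Sum>i\<in>W. fst (snd (w' i))) = (\<Sum>i\<in>V. fst (snd (w i)))"
    by (simp add: sum_extend[OF \<open>finite W\<close> \<open>V \<subseteq> W\<close>])
  have "(\<Sum>i\<in>W. snd (snd (w' i))) = (\<Sum>i\<in>W. if i \<in> V then snd (snd (w i)) else 0)"
    by (intro sum.cong) (auto simp: w'_def)
  then have snd_sum: "(\<Sum>i\<in>W. snd (snd (w' i))) = (\<Sum>i\<in>V. snd (snd (w i)))"
    by (simp add: sum_extend[OF \<open>finite W\<close> \<open>V \<subseteq> W\<close>])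
  have "(\<Sum>i\<in>W. f i (w' i)) = (\<Sum>i\<in>W. if i \<in> V then f i (w i) else standalone_value D f i)"
    using z \<open>W \<subseteq> U\<close> by (intro sum.cong) (auto simp: w'_def)
  then have utility: "(\<Sum>i\<in>W. f i (w' i)) =
      (\<Sum>i\<in>V. f i (w i)) + (\<Sum>i\<in>W - V. standalone_value D f i)"
    by (simp add: sum_extend[OF \<open>finite W\<close> \<open>V \<subseteq> W\<close>])
  have "w i \<in> D i" if "i \<in> V" for i
    using that w(1) by (auto simp: feasible_def intro: PiE_mem)
  moreover have "(z i, 0) \<in> D i" if "i \<in> W" for i
    using that z \<open>W \<subseteq> U\<close> by blast
  ultimately have "w' \<in> PiE W D"
    by (simp add: w'_def PiE_iff)
  then have "w' \<in> feasible W"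
    using w(1) fst_sum snd_sum by (simp add: feasible_def)
  obtain u where u: "sharing_value D f fa (\<lambda>_. 0) W = payoff (\<lambda>_. 0) W u"
    "\<And>w'. w' \<in> feasible W \<Longrightarrow> payoff (\<lambda>_. 0) W w' \<le> payoff (\<lambda>_. 0) W u"
    using sharing_attained[OF \<open>W \<subseteq> U\<close>, where d = "\<lambda>_. 0"] by blast
  have "payoff (\<lambda>_. 0) W w' = payoff (\<lambda>_. 0) V w + (\<Sum>i\<in>W - V. standalone_value D f i)"
    by (simp add: payoff_def fst_sum utility)
  then show ?thesis
    using u(2)[OF \<open>w' \<in> feasible W\<close>] u(1) w(2) by simp
qed

lemma standalone_le_sharing:
  assumes "W \<subseteq> U"
  shows "(\<Sum>i\<in>W. standalone_value D f i) \<le> sharing_value D f fa (\<lambda>_. 0) W"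
proof -
  \<comment> \<open>With no users both sums are empty, leaving \<open>fa 0\<close>.\<close>
  have "sharing_value D f fa (\<lambda>_. 0) {} = 0"
    using sharing_attained[of "{}" "\<lambda>_. 0"] by (auto simp: payoff_def fa_zero)
  then show ?thesis
    using sharing_value_superset[of "{}" W] assms by simp
qed

section \<open>Coalition values with and without fees\<close>

abbreviation "v \<equiv> esg_value U a D f fa c"
abbreviation "v0 \<equiv> esg_value U a D f fa (\<lambda>_. 0)"

lemma value_fees:
  "v S = (if a \<in> S \<and> card (S \<inter> U) \<ge> 2 then v0 S - sum c (S \<inter> U) else 0)"
  using sharing_value_fees[of "S \<inter> U" c] by (simp add: esg_value_def)

lemma value_few_users: "\<not> (a \<in> S \<and> card (S \<inter> U) \<ge> 2) \<Longrightarrow> esg_value U a D f fa d S = 0"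
  by (auto simp: esg_value_def)

text \<open>If \<open>S\<close> can share, the standalone values of its users cancel in
  \<open>sharing_value_superset\<close>. Otherwise \<open>S\<close> is worth zero, and
  \<open>v0 T\<close> is nonnegative since not sharing is feasible.\<close>

lemma zero_fee_monotonic: "monotonic_game (insert a U) v0"
  unfolding monotonic_game_def
proof (intro allI impI)
  fix S T assume ST: "S \<subseteq> T \<and> T \<subseteq> insert a U"
  show "v0 S \<le> v0 T"
  proof (cases "a \<in> S \<and> card (S \<inter> U) \<ge> 2")
    case True
    have "card (S \<inter> U) \<le> card (T \<inter> U)"
      using ST finite_users by (intro card_mono) auto
    then have T: "a \<in> T \<and> card (T \<inter> U) \<ge> 2"
      using True ST by auto
    have "(\<Sum>i\<in>T \<inter> U. standalone_value D f i) =
        (\<Sum>i\<in>T \<inter> U - S \<inter> U. standalone_value D f i) + (\<Sum>i\<in>S \<inter> U. standalone_value D f i)"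
      using ST finite_users by (intro sum.subset_diff) auto
    moreover have "S \<inter> U \<subseteq> T \<inter> U"
      using ST by blast
    ultimately show ?thesis
      using sharing_value_superset[of "S \<inter> U" "T \<inter> U"] True T by (simp add: esg_value_def)
  next
    case False
    then show ?thesis
      using value_few_users[OF False] standalone_le_sharing[of "T \<inter> U"]
      by (auto simp: esg_value_def)
  qed
qed

lemma grand_value: "v (insert a U) = v0 (insert a U) - sum c U"
  using value_fees[of "insert a U"] card_users aggregator by (simp add: Int_absorb1 subset_insertI)

lemma aggregator_game_esg: "aggregator_game U a (esg_value U a D f fa d)"
  using finite_users card_users aggregator by unfold_locales (auto simp: esg_value_def)

text \<open>If \<open>S\<close> can share, its members pay in both \<open>S\<close> and the grand
  coalition, so only the fees outside \<open>S\<close> survive. If it cannot, it pays none and all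
  fees survive.\<close>

lemma excess_fees:
  assumes S: "S \<in> proper_coalitions_with (insert a U) a"
  shows "v (insert a U) - v S =
    v0 (insert a U) - v0 S - sum c (if card (S \<inter> U) \<ge> 2 then U - S else U)"
proof (cases "card (S \<inter> U) \<ge> 2")
  case True
  have "sum c U = sum c (U - S) + sum c (S \<inter> U)"
    using sum.Int_Diff[OF finite_users, of c S] by (simp add: Int_commute add.commute)
  then show ?thesis
    using True S grand_value value_fees[of S] by (simp add: proper_coalitions_with_def)
next
  case False
  then show ?thesis
    using grand_value value_few_users[of S] by simp
qed

lemma threshold_le_zero_fee: "core_threshold U a v \<le> core_threshold U a v0"
proof -
  interpret G: aggregator_game U a v by (rule aggregator_game_esg)
  interpret G0: aggregator_game U a v0 by (rule aggregator_game_esg)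
  show ?thesis
    unfolding G0.le_threshold_iff
  proof
    fix S assume S: "S \<in> proper_coalitions_with (insert a U) a"
    have "sum c (if card (S \<inter> U) \<ge> 2 then U - S else U) \<ge> 0"
      by (intro sum_nonneg fee_nonneg) (auto split: if_splits)
    then have "excess_ratio U a v S \<le> excess_ratio U a v0 S"
      unfolding excess_ratio_def using excess_fees[OF S] G.denominator_pos[of S]
      by (intro divide_right_mono) auto
    then show "core_threshold U a v \<le> excess_ratio U a v0 S"
      using G.threshold_le[OF S] by linarith
  qed
qed

text \<open>The two games are compared at a coalition \<open>S\<close> minimising the ratio with
  fees, or at \<open>{a}\<close> if \<open>S\<close> cannot share. The fees lost in the numerator
  number at most one less than the denominator, so with a positive maximal fee the ratio drops by
  strictly less than that fee.\<close>

lemma threshold_gt_zero_fee: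
  assumes nonneg: "0 \<le> core_threshold U a v" and pos: "Max (c ` U) > 0"
  shows "core_threshold U a v0 - Max (c ` U) < core_threshold U a v"
proof -
  interpret G: aggregator_game U a v by (rule aggregator_game_esg)
  interpret G0: aggregator_game U a v0 by (rule aggregator_game_esg)
  let ?m = "Max (c ` U)" and ?k = "real (card U) + 1"
  have fees: "sum c W \<le> real (card W) * ?m" if "W \<subseteq> U" for W
    using that finite_users by (intro sum_bounded_above) auto
  obtain S where S: "S \<in> proper_coalitions_with (insert a U) a"
    and eq: "core_threshold U a v = excess_ratio U a v S"
    using G.threshold_attained by blast
  let ?d = "?k - real (card (S \<inter> U))"
  have d: "?d > 0"
    using G.card_users_le[of S] by linarith
  show ?thesis
  proof (cases "card (S \<inter> U) \<ge> 2")
    case True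
    have "sum c (U - S) \<le> real (card (U - S)) * ?m"
      by (intro fees) auto
    \<comment> \<open>Strict because \<open>?d\<close> is \<open>card (U - S) + 1\<close> and
      \<open>?m\<close> is positive.\<close>
    also have "\<dots> < ?d * ?m"
      using pos G.coalition_split(3)[OF S] G.card_users_le[of S]
      by (intro mult_strict_right_mono) auto
    finally have "(v0 (insert a U) - v0 S) - ?d * ?m < v (insert a U) - v S"
      using excess_fees[OF S] True by simp
    then have "(v0 (insert a U) - v0 S - ?d * ?m) / ?d < (v (insert a U) - v S) / ?d"
      using d by (rule divide_strict_right_mono)
    then have "excess_ratio U a v0 S - ?m < excess_ratio U a v S"
      using d by (simp add: excess_ratio_def G.card_N diff_divide_distrib)
    then show ?thesis
      using eq G0.threshold_le[OF S] by linarith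
  next
    \<comment> \<open>Coalitions with at most one user are worthless; as \<open>v N \<ge> 0\<close>, \<open>{a}\<close> has the smallest ratio among them.\<close>
    case False
    have vS: "v S = 0" "v {a} = 0" "v0 {a} = 0"
      using False aggregator by (auto intro: value_few_users)
    have k: "?k > 0" by simp
    \<comment> \<open>The nonnegative threshold equals \<open>v (insert a U) / ?d\<close> here, with
      \<open>?d\<close> positive.\<close>
    have "v (insert a U) \<ge> 0"
      using nonneg d eq vS by (simp add: excess_ratio_def G.card_N zero_le_divide_iff)
    then have "v (insert a U) / ?k \<le> core_threshold U a v"
      unfolding eq excess_ratio_def G.card_N vS using d by (intro frac_le) auto
    moreover have "sum c U < ?k * ?m"
      using fees[of U] pos by (simp add: algebra_simps)
    then have "(v0 (insert a U) - ?k * ?m) / ?k < v (insert a U) / ?k"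
      using k grand_value by (intro divide_strict_right_mono) auto
    then have "v0 (insert a U) / ?k - ?m < v (insert a U) / ?k"
      using k by (simp add: diff_divide_distrib)
    moreover have "core_threshold U a v0 \<le> v0 (insert a U) / ?k"
      using G0.threshold_le_average vS G.card_N by simp
    ultimately show ?thesis by linarith
  qed
qed

end

section \<open>Assembly of the claims (a) to (e)\<close>

theorem theorem5:
  fixes U :: "'p set"
    and a :: 'p
    and n :: "'p \<Rightarrow> nat"
    and D :: "'p \<Rightarrow> 'm::finite point set"
    and f :: "'p \<Rightarrow> 'm point \<Rightarrow> real"
    and fa :: "real ^ 'm \<Rightarrow> real"
    and c :: "'p \<Rightarrow> real"
  assumes "energy_sharing_game U a n D f fa c"
  shows
    "let N = insert a U;
         v = esg_value U a D f fa c;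
         v\<^sub>0 = esg_value U a D f fa (\<lambda>_. 0);
         \<epsilon>s = least_core_value N v;
         \<epsilon>s\<^sub>0 = least_core_value N v\<^sub>0;
         cmax = Max (c ` U);
         \<epsilon>hat = Min ((\<lambda>S. (v N - v S) / (real (card N) - real (card (S \<inter> U))))
                     ` proper_coalitions_with N a);
         vmax = Max (v ` max_coalitions_with N a);
         alloc = (\<lambda>\<epsilon>. \<lambda>i\<in>N. if i = a then v N - \<epsilon> * real (card U) else \<epsilon>)
     in
       (\<forall>\<epsilon>\<ge>0. (strong_core N v \<epsilon> \<noteq> {} \<longleftrightarrow> alloc \<epsilon> \<in> strong_core N v \<epsilon>) \<and>
              (alloc \<epsilon> \<in> strong_core N v \<epsilon> \<longleftrightarrow> \<epsilon> \<le> \<epsilon>hat)) \<and>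
       (core N v \<noteq> {} \<longrightarrow> \<epsilon>s = \<epsilon>hat) \<and>
       (core N v \<noteq> {} \<and> cmax > 0 \<longrightarrow> \<epsilon>s\<^sub>0 - cmax < \<epsilon>s \<and> \<epsilon>s \<le> \<epsilon>s\<^sub>0) \<and>
       (monotonic_game N v \<longrightarrow> \<epsilon>s \<ge> (v N - vmax) / real (card N)) \<and>
       (core N v \<noteq> {} \<longrightarrow>
          \<epsilon>s \<le> Min {\<epsilon>s\<^sub>0, v N / real (card N), (v N - vmax) / 2})"
proof -
  interpret energy_sharing_game U a n D f fa c by (rule assms)
  interpret G: aggregator_game U a v by (rule aggregator_game_esg)
  interpret G0: aggregator_game U a v0 by (rule aggregator_game_esg)
  have threshold: "Min ((\<lambda>S. (v (insert a U) - v S) /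
      (real (card (insert a U)) - real (card (S \<inter> U)))) ` proper_coalitions_with (insert a U) a)
      = core_threshold U a v"
    by (simp add: core_threshold_def excess_ratio_def)
  have A: "(strong_core (insert a U) v \<epsilon> \<noteq> {} \<longleftrightarrow>
        uniform_allocation U a v \<epsilon> \<in> strong_core (insert a U) v \<epsilon>) \<and>
      (uniform_allocation U a v \<epsilon> \<in> strong_core (insert a U) v \<epsilon> \<longleftrightarrow> \<epsilon> \<le> core_threshold U a v)"
    if "\<epsilon> \<ge> 0" for \<epsilon>
    using that G.strong_core_le_threshold G.uniform_allocation_in_strong_core by blast
  \<comment> \<open>Monotonicity without fees gives a nonempty core, so the fee-free least core
    value is its threshold whatever the fees are.\<close>
  have core0: "least_core_value (insert a U) v0 = core_threshold U a v0"
    using G0.least_core_value_eq G0.monotonic_core_nonempty zero_fee_monotonic by blast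
  have "v {a} = 0"
    using aggregator by (intro value_few_users) simp
  then have E: "core_threshold U a v \<le> Min {core_threshold U a v0,
      v (insert a U) / real (card (insert a U)),
      (v (insert a U) - Max (v ` max_coalitions_with (insert a U) a)) / 2}"
    using threshold_le_zero_fee G.threshold_le_average G.threshold_le_max_coalition by simp
  \<comment> \<open>In (d) the nonempty core is not assumed but follows from monotonicity, which
    identifies the least core value with the threshold.\<close>
  have D: "(v (insert a U) - Max (v ` max_coalitions_with (insert a U) a)) /
      real (card (insert a U)) \<le> least_core_value (insert a U) v"
    if "monotonic_game (insert a U) v"
    using that G.least_core_value_eq G.monotonic_core_nonempty G.monotonic_threshold_ge(2) by simp
  show ?thesis
    unfolding Let_def threshold core0 uniform_allocation_def[symmetric]
    using A G.least_core_value_eq threshold_le_zero_fee threshold_gt_zero_fee D E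
      G.core_nonempty_iff
    by simp
qed

end
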